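(* Let $n,d\in\mathbb{N}$ with $d\in\{1,\ldots,n\}$ and let $(X,\|\cdot\|_X)$ be a complex Banach space. For every $p\in[1,\infty]$ and every function $f:\{-1,1\}^n\to X$ of degree at most $d$, we have $$\|\Delta f\|_{L_p(\{-1,1\}^n;X)}\leq d^2\,\|f\|_{L_p(\{-1,1\}^n;X)}.$$
   Context: $\mathbb{N}=\{1,2,\ldots\}$. For $p\in[1,\infty)$, $\|f\|_{L_p(\{-1,1\}^n;X)}=\big(2^{-n}\sum_{\varepsilon\in\{-1,1\}^n}\|f(\varepsilon)\|_X^p\big)^{1/p}$, and $\|f\|_{L_\infty(\{-1,1\}^n;X)}=\max_{\varepsilon}\|f(\varepsilon)\|_X$. For $A\subseteq\{1,\ldots,n\}$, the Walsh function is $w_A(\varepsilon)=\prod_{i\in A}\varepsilon_i$. Every $f:\{-1,1\}^n\to X$ has the expansion $f=\sum_{A}\widehat f(A)w_A$ with $\widehat f(A)=2^{-n}\sum_{\delta\in\{-1,1\}^n}f(\delta)w_A(\delta)\in X$. The hypercube Laplacian is $\Delta f=\sum_A|A|\widehat f(A)w_A$. A function $f$ has degree at most $d$ if $\widehat f(A)=0$ whenever $|A|>d$. *)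

theory Defs
  imports "HOL-Analysis.Analysis"
begin

text \<open>Complex Banach spaces. The real scalar multiplication inherited from \<^class>\<open>real_vector\<close> is the
  restriction of the complex one.\<close>

class complex_vector = real_vector +
  fixes scaleC :: "complex \<Rightarrow> 'a \<Rightarrow> 'a"  (infixr \<open>*\<^sub>C\<close> 75)
  assumes scaleC_add_right: "a *\<^sub>C (x + y) = a *\<^sub>C x + a *\<^sub>C y"
    and scaleC_add_left: "(a + b) *\<^sub>C x = a *\<^sub>C x + b *\<^sub>C x"
    and scaleC_scaleC: "a *\<^sub>C (b *\<^sub>C x) = (a * b) *\<^sub>C x"
    and scaleC_one: "1 *\<^sub>C x = x"
    and scaleR_scaleC: "r *\<^sub>R x = complex_of_real r *\<^sub>C x"

class complex_normed_vector = complex_vector + real_normed_vector +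
  assumes norm_scaleC: "norm (a *\<^sub>C x) = cmod a * norm x"

class complex_banach = complex_normed_vector + banach

instantiation complex :: complex_banach
begin

definition scaleC_complex :: "complex \<Rightarrow> complex \<Rightarrow> complex"
  where "scaleC_complex a x = a * x"

instance
  by standard (simp_all add: scaleC_complex_def algebra_simps norm_mult scaleR_conv_of_real)

end

text \<open>A point of the hypercube \<open>{-1,1}\<^sup>n\<close> is a function on \<open>{1..n}\<close>, taking the value
  \<^const>\<open>undefined\<close> elsewhere; so the hypercube has exactly \<open>2\<^sup>n\<close> elements. Functions
  on the hypercube are total HOL functions whose values off the hypercube are never inspected.\<close>

definition hypercube :: "nat \<Rightarrow> (nat \<Rightarrow> real) set"
  where "hypercube n = {1..n} \<rightarrow>\<^sub>E {-1, 1}"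

definition walsh :: "nat set \<Rightarrow> (nat \<Rightarrow> real) \<Rightarrow> real"
  where "walsh A \<epsilon> = (\<Prod>i\<in>A. \<epsilon> i)"

definition fourier_coeff :: "nat \<Rightarrow> ((nat \<Rightarrow> real) \<Rightarrow> 'a::real_vector) \<Rightarrow> nat set \<Rightarrow> 'a"
  where "fourier_coeff n f A = (1 / 2 ^ n) *\<^sub>R (\<Sum>\<delta>\<in>hypercube n. walsh A \<delta> *\<^sub>R f \<delta>)"

definition degree_at_most :: "nat \<Rightarrow> nat \<Rightarrow> ((nat \<Rightarrow> real) \<Rightarrow> 'a::real_vector) \<Rightarrow> bool"
  where "degree_at_most n d f \<longleftrightarrow> (\<forall>A \<subseteq> {1..n}. d < card A \<longrightarrow> fourier_coeff n f A = 0)"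

definition laplacian :: "nat \<Rightarrow> ((nat \<Rightarrow> real) \<Rightarrow> 'a::real_vector) \<Rightarrow> (nat \<Rightarrow> real) \<Rightarrow> 'a"
  where "laplacian n f \<epsilon> =
    (\<Sum>A\<in>Pow {1..n}. real (card A) *\<^sub>R walsh A \<epsilon> *\<^sub>R fourier_coeff n f A)"

text \<open>Intended for exponents \<open>1 \<le> p \<le> \<infinity>\<close>; the measure is normalised.\<close>

definition cube_Lp_norm ::
    "nat \<Rightarrow> ereal \<Rightarrow> ((nat \<Rightarrow> real) \<Rightarrow> 'a::real_normed_vector) \<Rightarrow> real"
  where "cube_Lp_norm n p f =
    (if p = \<infinity> then Max ((\<lambda>\<epsilon>. norm (f \<epsilon>)) ` hypercube n)
     else ((1 / 2 ^ n) * (\<Sum>\<epsilon>\<in>hypercube n. norm (f \<epsilon>) powr real_of_ereal p))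
            powr (1 / real_of_ereal p))"

end

theory Submission
  imports Defs
begin

text \<open>
  For \<open>\<rho> \<in> [-1, 1]\<close> let \<open>T\<^sub>\<rho>\<close> be the noise operator, which multiplies the coefficient of
  \<open>w\<^sub>A\<close> by \<open>\<rho> ^ |A|\<close>. It averages \<open>f\<close> against a nonnegative doubly stochastic kernel, so it contracts
  every \<open>L\<^sub>p\<close>. If \<open>f\<close> has degree at most \<open>d\<close>, then \<open>\<rho> \<mapsto> T\<^sub>\<rho> f\<close> is a vector-valued polynomial of degree
  at most \<open>d\<close> whose derivative at \<open>\<rho> = 1\<close> is the Laplacian of \<open>f\<close>, and the bound is the
  inequality of the Markov brothers for that polynomial.

  A quadrature form of that inequality carries it over to vectors. There are weights
  \<open>c\<^sub>j\<close> such that \<open>q'(1) = (\<Sum>j. c\<^sub>j q(cos (\<pi> j / d)))\<close> for all polynomials \<open>q\<close> of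
  degree at most \<open>d\<close> (lemma \<open>node_sum_power\<close>) and \<open>(\<Sum>j. |c\<^sub>j|) = d\<^sup>2\<close> (lemma
  \<open>sum_abs_node_weight\<close>). Hence the Laplacian is the combination \<open>\<Sum>j. c\<^sub>j T\<^bsub>cos (\<pi> j / d)\<^esub>\<close> on
  functions of degree at most \<open>d\<close>, and its norm at a point is at most \<open>d\<^sup>2\<close> times a doubly stochastic
  average of the norms of \<open>f\<close>. Jensen's inequality finishes the proof for all exponents at once
  (lemma \<open>cube_Lp_norm_stochastic_kernel\<close>).

  To find the weights, put \<open>\<rho> = cos \<theta>\<close>: since \<open>q'(1)\<close> is minus the second derivative of
  \<open>q(cos \<theta>)\<close> at \<open>\<theta> = 0\<close>, what is needed is \<open>(\<Sum>j. c\<^sub>j cos (k \<theta>\<^sub>j)) = k\<^sup>2\<close> for \<open>0 \<le> k \<le> d\<close>.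
  On the \<open>2 d\<close> equispaced angles \<open>\<theta>\<^sub>j = \<pi> j / d\<close> the
  inverse discrete Fourier transform solves this. Pulling out \<open>(-1) ^ j = cos (d \<theta>\<^sub>j)\<close> moves the
  frequency \<open>d\<close> to \<open>0\<close> and leaves the transform of \<open>m \<mapsto> (d - |m|)\<^sup>2\<close>. This
  sequence is convex, hence a nonnegative combination of the triangular sequences
  \<open>max 0 (r - |m|)\<close>, whose transforms are the Fejer kernels \<open>|\<Sum>s<r. e ^ (i s \<theta>)|\<^sup>2 \<ge> 0\<close>. So \<open>c\<^sub>j\<close> has
  the sign \<open>(-1) ^ j\<close>, and the sum of the \<open>|c\<^sub>j|\<close> is the case \<open>k = d\<close>.
\<close>

section \<open>A quadrature formula for the derivative at 1\<close>

definition node :: "nat \<Rightarrow> nat \<Rightarrow> real"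
  where "node d j = pi * real j / real d"

definition geom_cis :: "nat \<Rightarrow> real \<Rightarrow> complex"
  where "geom_cis r \<theta> = (\<Sum>s<r. cis (real s * \<theta>))"

text \<open>The combination of Fejer kernels mirrors \<open>x\<^sup>2 = x + 2 (\<Sum>r<d. max 0 (x - d + r))\<close> for
  integers \<open>0 \<le> x \<le> d\<close>, read at \<open>x = d - |m|\<close>; so the coefficient of frequency \<open>m\<close> is
  \<open>(d - |m|)\<^sup>2\<close>.\<close>

definition positive_kernel :: "nat \<Rightarrow> real \<Rightarrow> real"
  where "positive_kernel d \<theta> = (cmod (geom_cis d \<theta>))\<^sup>2 + 2 * (\<Sum>r<d. (cmod (geom_cis r \<theta>))\<^sup>2)"

definition node_weight :: "nat \<Rightarrow> nat \<Rightarrow> real"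
  where "node_weight d j = (-1) ^ j / (2 * real d) * positive_kernel d (node d j)"

lemma sum_cis_node:
  assumes "d > 0"
  shows "(\<Sum>j<2*d. cis (of_int m * node d j)) = (if 2 * int d dvd m then of_nat (2 * d) else 0)"
proof -
  define z where "z = cis (of_int m * pi / real d)"
  have pow: "cis (of_int m * node d j) = z ^ j" for j
    by (simp add: z_def Complex.DeMoivre node_def mult_ac)
  show ?thesis
  proof (cases "2 * int d dvd m")
    case True
    then obtain q where q: "m = 2 * int d * q" by auto
    have "z = 1"
    proof -
      have "of_int m * pi / real d = 2 * pi * of_int q"
        using assms by (simp add: q)
      then show ?thesis by (simp add: z_def)
    qed
    then show ?thesis using True pow by simp
  next
    case False
    have "z \<noteq> 1"
    proof
      assume "z = 1"
      then have "cos (of_int m * pi / real d) = 1"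
        by (simp add: z_def complex_eq_iff)
      then obtain q :: int where "of_int m * pi / real d = of_int q * 2 * pi"
        using cos_one_2pi_int by blast
      then have "real_of_int m = real_of_int (2 * int d * q)"
        using assms by (simp add: field_simps)
      then have "m = 2 * int d * q" by linarith
      with False show False by simp
    qed
    moreover have "z ^ (2 * d) = 1"
    proof -
      have "z ^ (2 * d) = cis (2 * pi * of_int m)"
        using assms by (simp add: z_def Complex.DeMoivre mult_ac)
      then show ?thesis by simp
    qed
    ultimately show ?thesis
      using False pow by (simp add: sum_gp_strict)
  qed
qed

lemma cmod_geom_cis_squared:
  "of_real ((cmod (geom_cis r \<theta>))\<^sup>2) = (\<Sum>s<r. \<Sum>t<r. cis (of_int (int s - int t) * \<theta>))"
proof -
  have "of_real ((cmod (geom_cis r \<theta>))\<^sup>2) = geom_cis r \<theta> * cnj (geom_cis r \<theta>)"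
    by (rule complex_norm_square)
  also have "\<dots> = (\<Sum>s<r. \<Sum>t<r. cis (real s * \<theta>) * cis (- (real t * \<theta>)))"
    by (simp add: geom_cis_def sum_product cis_cnj)
  also have "\<dots> = (\<Sum>s<r. \<Sum>t<r. cis (of_int (int s - int t) * \<theta>))"
    by (simp add: cis_mult algebra_simps)
  finally show ?thesis .
qed

text \<open>This number of pairs is the coefficient of frequency \<open>e\<close> in the Fejer kernel of order \<open>r\<close>.
  The truncated subtraction is intended: there are no such pairs for \<open>e \<ge> r\<close>.\<close>

lemma card_difference_pairs:
  "(\<Sum>s<r. \<Sum>t<r. if s = t + e then 1 else 0 :: 'a :: semiring_1) = of_nat (r - e)"
proof -
  have "(\<Sum>s<r. \<Sum>t<r. if s = t + e then 1 else 0 :: 'a)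
      = (\<Sum>t<r. \<Sum>s<r. if s = t + e then 1 else 0)"
    by (rule sum.swap)
  also have "\<dots> = (\<Sum>t<r. if t < r - e then 1 else 0)"
    by (rule sum.cong) auto
  also have "\<dots> = (\<Sum>t<r - e. 1)"
    by (rule sum.mono_neutral_cong_right) auto
  finally show ?thesis by simp
qed

text \<open>The sign \<open>(-1) ^ j\<close> shifts frequencies by \<open>d\<close>, so by orthogonality the sum over the nodes picks
  the coefficient of frequency \<open>d - k\<close> from the Fejer kernel of order \<open>r\<close>.\<close>

lemma node_sum_geom_cis:
  assumes "d > 0" "r \<le> d" "k \<le> d"
  shows "(\<Sum>j<2*d. (-1) ^ j * (cmod (geom_cis r (node d j)))\<^sup>2 * cos (real k * node d j))
         = 2 * real d * real (r - (d - k))" (is "?lhs = ?rhs")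
proof -
  have sign: "(-1) ^ j = cis (real d * node d j)" for j
  proof -
    have "real d * node d j = real j * pi"
      using assms by (simp add: node_def)
    then show ?thesis by (simp flip: Complex.DeMoivre)
  qed
  define S where "S = (\<Sum>j<2*d. (-1) ^ j * of_real ((cmod (geom_cis r (node d j)))\<^sup>2)
                             * cis (real k * node d j))"
  have "S = (\<Sum>j<2*d. \<Sum>s<r. \<Sum>t<r.
      cis (real_of_int (int s - int t + int d + int k) * node d j))"
    unfolding S_def cmod_geom_cis_squared sign
    by (simp add: sum_distrib_left sum_distrib_right cis_mult algebra_simps)
  also have "\<dots> = (\<Sum>s<r. \<Sum>t<r. \<Sum>j<2*d.
      cis (real_of_int (int s - int t + int d + int k) * node d j))"
    by (subst sum.swap, rule sum.cong[OF refl], subst sum.swap, rule refl)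
  also have "\<dots> = (\<Sum>s<r. \<Sum>t<r. of_nat (2 * d) * (if s = t + (d - k) then 1 else 0))"
  proof (intro sum.cong refl)
    fix s t assume st: "s \<in> {..<r}" "t \<in> {..<r}"
    let ?m = "int s - int t + int d + int k"
    \<comment> \<open>The frequency lies strictly between 0 and \<open>4 d\<close>, so only the multiple \<open>2 d\<close> survives.\<close>
    have "2 * int d dvd ?m \<longleftrightarrow> s = t + (d - k)"
    proof
      assume "2 * int d dvd ?m"
      then obtain q where q: "?m = 2 * int d * q" by auto
      have "0 < 2 * int d * q" "2 * int d * q < 2 * int d * 2"
        unfolding q[symmetric] using st assms by auto
      then have "0 < q" "q < 2"
        using assms by (auto simp: zero_less_mult_iff)
      then have "q = 1" by simp
      with q show "s = t + (d - k)" using assms by simp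
    qed (use assms in auto)
    then show "(\<Sum>j<2*d. cis (real_of_int ?m * node d j))
        = of_nat (2 * d) * (if s = t + (d - k) then 1 else 0)"
      by (simp only: sum_cis_node[OF assms(1)]) auto
  qed
  also have "\<dots> = of_nat (2 * d) * of_nat (r - (d - k))"
    by (simp only: card_difference_pairs flip: sum_distrib_left)
  finally have S: "S = of_real ?rhs" by simp
  have "?lhs = Re S"
    unfolding S_def Re_sum
  proof (intro sum.cong refl)
    fix j
    have "(-1) ^ j * of_real ((cmod (geom_cis r (node d j)))\<^sup>2)
        = (of_real ((-1) ^ j * (cmod (geom_cis r (node d j)))\<^sup>2) :: complex)"
      by simp
    then show "(-1) ^ j * (cmod (geom_cis r (node d j)))\<^sup>2 * cos (real k * node d j)
       = Re ((-1) ^ j * of_real ((cmod (geom_cis r (node d j)))\<^sup>2) * cis (real k * node d j))"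
      by (metis Re_complex_of_real cis.sel(1) times_complex.sel(1) Im_complex_of_real mult_zero_left diff_zero)
  qed
  also have "\<dots> = ?rhs" unfolding S by simp
  finally show ?thesis .
qed

lemma sum_truncated_differences:
  assumes "e \<le> d"
  shows "real (d - e) + 2 * (\<Sum>r<d. real (r - e)) = (real d - real e)\<^sup>2"
  using assms
proof (induction d rule: dec_induct)
  case (step d)
  then show ?case by (simp add: of_nat_diff power2_eq_square algebra_simps)
qed simp

text \<open>The weights reproduce minus the second derivative at \<open>0\<close> of \<open>cos (k \<theta>)\<close>.\<close>

lemma node_sum_cos:
  assumes "d > 0" "k \<le> d"
  shows "(\<Sum>j<2*d. node_weight d j * cos (real k * node d j)) = (real k)\<^sup>2"
proof -
  let ?G = "\<lambda>r j. (-1) ^ j * (cmod (geom_cis r (node d j)))\<^sup>2 * cos (real k * node d j)"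
  have "node_weight d j * cos (real k * node d j)
      = (?G d j + 2 * (\<Sum>r<d. ?G r j)) / (2 * real d)" for j
    by (simp add: node_weight_def positive_kernel_def sum_distrib_left sum_distrib_right
        algebra_simps add_divide_distrib sum_divide_distrib)
  then have "(\<Sum>j<2*d. node_weight d j * cos (real k * node d j))
      = ((\<Sum>j<2*d. ?G d j) + 2 * (\<Sum>r<d. \<Sum>j<2*d. ?G r j)) / (2 * real d)"
    by (simp add: sum.distrib sum.swap[of _ "{..<d}" "{..<2*d}"] flip: sum_divide_distrib sum_distrib_left)
  also have "\<dots> = (2 * real d * (real (d - (d - k)) + 2 * (\<Sum>r<d. real (r - (d - k))))) / (2 * real d)"
  proof -
    have "(\<Sum>r<d. \<Sum>j<2*d. ?G r j) = (\<Sum>r<d. 2 * real d * real (r - (d - k)))"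
      using assms by (intro sum.cong refl node_sum_geom_cis) auto
    then show ?thesis
      using node_sum_geom_cis[OF assms(1) order_refl assms(2)]
      by (simp add: distrib_left flip: sum_distrib_left)
  qed
  also have "\<dots> = (real k)\<^sup>2"
    using assms sum_truncated_differences[of "d - k" d] by (simp add: of_nat_diff)
  finally show ?thesis .
qed

text \<open>The right-hand side is minus the second derivative of \<open>cos \<theta> ^ m * cos (k \<theta>)\<close> at \<open>0\<close>. The extra
  factor \<open>cos (k \<theta>)\<close> lets the induction convert one power of the cosine at a time into frequencies;
  integer \<open>k\<close> spares a case distinction at \<open>k - 1\<close>.\<close>

lemma node_sum_cos_power_cos:
  assumes "d > 0" "int m + \<bar>k\<bar> \<le> int d"
  shows "(\<Sum>j<2*d. node_weight d j * cos (node d j) ^ m * cos (of_int k * node d j))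
         = real m + (of_int k)\<^sup>2"
  using assms(2)
proof (induction m arbitrary: k)
  case 0
  have "cos (of_int k * \<theta>) = cos (real (nat \<bar>k\<bar>) * \<theta>)" for \<theta>
    by (cases "k \<ge> 0") auto
  then show ?case
    using node_sum_cos[OF assms(1), of "nat \<bar>k\<bar>"] 0 by simp
next
  case (Suc m)
  have "cos \<theta> * cos (of_int k * \<theta>)
      = (cos (of_int (k + 1) * \<theta>) + cos (of_int (k - 1) * \<theta>)) / 2" for \<theta> :: real
    by (simp add: distrib_right left_diff_distrib cos_add cos_diff)
  note product_to_sum = this
  have "(\<Sum>j<2*d. node_weight d j * cos (node d j) ^ Suc m * cos (of_int k * node d j))
      = (\<Sum>j<2*d. (node_weight d j * cos (node d j) ^ m * cos (of_int (k + 1) * node d j)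
         + node_weight d j * cos (node d j) ^ m * cos (of_int (k - 1) * node d j)) / 2)"
  proof (intro sum.cong refl)
    fix j
    have "node_weight d j * cos (node d j) ^ Suc m * cos (of_int k * node d j)
        = node_weight d j * cos (node d j) ^ m * (cos (node d j) * cos (of_int k * node d j))"
      by simp
    then show "node_weight d j * cos (node d j) ^ Suc m * cos (of_int k * node d j)
        = (node_weight d j * cos (node d j) ^ m * cos (of_int (k + 1) * node d j)
         + node_weight d j * cos (node d j) ^ m * cos (of_int (k - 1) * node d j)) / 2"
      unfolding product_to_sum by (simp add: distrib_left)
  qed
  also have "\<dots> = ((real m + (of_int (k + 1))\<^sup>2) + (real m + (of_int (k - 1))\<^sup>2)) / 2"
    using Suc.IH[of "k + 1"] Suc.IH[of "k - 1"] Suc.prems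
    by (simp add: sum.distrib flip: sum_divide_distrib)
  also have "\<dots> = real (Suc m) + (of_int k)\<^sup>2"
    by (simp add: power2_eq_square algebra_simps)
  finally show ?case .
qed

text \<open>Differentiation at \<open>1\<close> of a polynomial of degree at most \<open>d\<close>, tested on monomials.\<close>

lemma node_sum_power:
  assumes "d > 0" "m \<le> d"
  shows "(\<Sum>j<2*d. node_weight d j * cos (node d j) ^ m) = real m"
  using node_sum_cos_power_cos[of d m 0] assms by simp

text \<open>The weights alternate in sign exactly as \<open>cos (d \<theta>)\<close> does at the nodes, where it is \<open>\<plusminus>1\<close>. So the
  sum of absolute values is the quadrature formula applied to the Chebyshev polynomial, the
  extremal function of Markov's inequality.\<close>

lemma sum_abs_node_weight:
  assumes "d > 0"
  shows "(\<Sum>j<2*d. \<bar>node_weight d j\<bar>) = (real d)\<^sup>2"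
proof -
  have "\<bar>node_weight d j\<bar> = node_weight d j * cos (real d * node d j)" for j
  proof -
    have "positive_kernel d (node d j) \<ge> 0"
      by (simp add: positive_kernel_def sum_nonneg)
    moreover have "cos (real d * node d j) = (-1) ^ j"
      using assms by (simp add: node_def mult.commute[of pi])
    ultimately show ?thesis
      by (simp add: node_weight_def abs_mult power_abs flip: power_mult_distrib)
  qed
  then show ?thesis using node_sum_cos[of d d] assms by simp
qed

section \<open>The noise kernel\<close>

definition noise_kernel :: "nat \<Rightarrow> real \<Rightarrow> (nat \<Rightarrow> real) \<Rightarrow> (nat \<Rightarrow> real) \<Rightarrow> real"
  where "noise_kernel n \<rho> \<epsilon> \<delta> = (1 / 2 ^ n) * (\<Prod>i\<in>{1..n}. 1 + \<rho> * \<epsilon> i * \<delta> i)"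

lemma noise_kernel_commute: "noise_kernel n \<rho> \<epsilon> \<delta> = noise_kernel n \<rho> \<delta> \<epsilon>"
  by (simp add: noise_kernel_def mult_ac)

lemma noise_kernel_nonneg:
  assumes "\<bar>\<rho>\<bar> \<le> 1" "\<epsilon> \<in> hypercube n" "\<delta> \<in> hypercube n"
  shows "0 \<le> noise_kernel n \<rho> \<epsilon> \<delta>"
proof -
  have "0 \<le> 1 + \<rho> * \<epsilon> i * \<delta> i" if "i \<in> {1..n}" for i
  proof -
    have "\<epsilon> i \<in> {-1, 1}" "\<delta> i \<in> {-1, 1}"
      using assms(2,3) that unfolding hypercube_def by (auto dest: PiE_mem)
    then show ?thesis using assms(1) by auto
  qed
  then have "0 \<le> (\<Prod>i\<in>{1..n}. 1 + \<rho> * \<epsilon> i * \<delta> i)"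
    by (intro prod_nonneg) blast
  then show ?thesis by (simp add: noise_kernel_def)
qed

lemma noise_kernel_sum: "(\<Sum>\<delta>\<in>hypercube n. noise_kernel n \<rho> \<epsilon> \<delta>) = 1"
proof -
  have "(\<Sum>\<delta>\<in>hypercube n. \<Prod>i\<in>{1..n}. 1 + \<rho> * \<epsilon> i * \<delta> i)
      = (\<Prod>i\<in>{1..n}. \<Sum>x\<in>{-1, 1}. 1 + \<rho> * \<epsilon> i * x)"
    unfolding hypercube_def by (rule prod_sum_PiE[symmetric]) auto
  then show ?thesis
    by (simp add: noise_kernel_def flip: sum_divide_distrib)
qed

text \<open>Expanding the product over subsets of \<open>{1..n}\<close> shows that the kernel acts on the coefficient of
  \<open>w\<^sub>A\<close> as multiplication by \<open>\<rho> ^ |A|\<close>.\<close>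

lemma noise_kernel_walsh_expansion:
  "(\<Sum>\<delta>\<in>hypercube n. noise_kernel n \<rho> \<epsilon> \<delta> *\<^sub>R f \<delta>)
   = (\<Sum>A\<in>Pow {1..n}. \<rho> ^ card A *\<^sub>R walsh A \<epsilon> *\<^sub>R fourier_coeff n f A)"
proof -
  have "noise_kernel n \<rho> \<epsilon> \<delta>
      = (\<Sum>A\<in>Pow {1..n}. \<rho> ^ card A * walsh A \<epsilon> * (1 / 2 ^ n) * walsh A \<delta>)" for \<delta>
  proof -
    have "(\<Prod>i\<in>{1..n}. \<rho> * \<epsilon> i * \<delta> i + 1)
        = (\<Sum>A\<in>Pow {1..n}. \<rho> ^ card A * walsh A \<epsilon> * walsh A \<delta>)"
      by (simp add: prod_add prod.distrib walsh_def)
    then show ?thesis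
      by (simp add: noise_kernel_def add.commute sum_divide_distrib)
  qed
  then show ?thesis
    by (simp add: fourier_coeff_def scaleR_sum_left scaleR_sum_right mult.assoc
        sum.swap[of _ "hypercube n"])
qed

lemma laplacian_eq_noise_combination:
  fixes f :: "(nat \<Rightarrow> real) \<Rightarrow> 'a::real_vector"
  assumes "d > 0" "degree_at_most n d f"
  shows "laplacian n f \<epsilon>
    = (\<Sum>j<2*d. node_weight d j *\<^sub>R
        (\<Sum>\<delta>\<in>hypercube n. noise_kernel n (cos (node d j)) \<epsilon> \<delta> *\<^sub>R f \<delta>))"
proof -
  have "(\<Sum>j<2*d. node_weight d j *\<^sub>R
        (\<Sum>\<delta>\<in>hypercube n. noise_kernel n (cos (node d j)) \<epsilon> \<delta> *\<^sub>R f \<delta>))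
      = (\<Sum>A\<in>Pow {1..n}. \<Sum>j<2*d. (node_weight d j * cos (node d j) ^ card A) *\<^sub>R
           walsh A \<epsilon> *\<^sub>R fourier_coeff n f A)"
    unfolding noise_kernel_walsh_expansion scaleR_sum_right
    by (subst sum.swap) (simp add: mult.assoc)
  also have "\<dots> = (\<Sum>A\<in>Pow {1..n}. (\<Sum>j<2*d. node_weight d j * cos (node d j) ^ card A) *\<^sub>R
           walsh A \<epsilon> *\<^sub>R fourier_coeff n f A)"
    by (simp only: scaleR_sum_left)
  also have "\<dots> = laplacian n f \<epsilon>"
    unfolding laplacian_def
  proof (intro sum.cong refl)
    fix A assume A: "A \<in> Pow {1..n}"
    show "(\<Sum>j<2*d. node_weight d j * cos (node d j) ^ card A) *\<^sub>R walsh A \<epsilon> *\<^sub>R fourier_coeff n f A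
        = real (card A) *\<^sub>R walsh A \<epsilon> *\<^sub>R fourier_coeff n f A"
    proof (cases "card A \<le> d")
      case True
      then show ?thesis using node_sum_power[OF assms(1)] by simp
    next
      case False
      then have "fourier_coeff n f A = 0"
        using assms(2) A unfolding degree_at_most_def by auto
      then show ?thesis by simp
    qed
  qed
  finally show ?thesis by simp
qed

section \<open>Doubly stochastic kernels\<close>

lemma finite_hypercube: "finite (hypercube n)"
  unfolding hypercube_def by (intro finite_PiE) auto

lemma hypercube_nonempty: "hypercube n \<noteq> {}"
  unfolding hypercube_def by (simp add: PiE_eq_empty_iff)

text \<open>Convexity up to the endpoint \<open>0\<close>, because the norms to be averaged may vanish.\<close>

lemma convex_on_powr_nonneg:
  assumes "p \<ge> 1"
  shows "convex_on {0..} (\<lambda>x::real. x powr p)"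
proof (intro convex_onI)
  fix t x y :: real
  assume t: "0 < t" "t < 1" and xy: "x \<in> {0..}" "y \<in> {0..}"
  have shrink: "s powr p \<le> s" if "0 < s" "s < 1" for s :: real
    using powr_mono'[of 1 p s] that assms by simp
  consider "x = 0" | "y = 0" | "x > 0" "y > 0" using xy by fastforce
  then show "((1 - t) *\<^sub>R x + t *\<^sub>R y) powr p \<le> (1 - t) * x powr p + t * y powr p"
  proof cases
    case 1
    then show ?thesis using shrink[of t] t xy by (simp add: powr_mult mult_right_mono)
  next
    case 2
    then show ?thesis using shrink[of "1 - t"] t xy by (simp add: powr_mult mult_right_mono)
  next
    case 3
    then show ?thesis
      using convex_onD[OF powr_convex[OF assms], of t x y] t by simp
  qed
qed simp

text \<open>For finite exponents, Jensen's inequality uses that the rows sum to one, and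
  summing over the cube then uses that the columns do. For \<open>p = \<infinity>\<close> an average is at most the maximum.\<close>

lemma cube_Lp_norm_stochastic_kernel:
  fixes f :: "(nat \<Rightarrow> real) \<Rightarrow> 'a::real_normed_vector"
    and g :: "(nat \<Rightarrow> real) \<Rightarrow> 'b::real_normed_vector"
  assumes p: "1 \<le> p" and C: "0 \<le> C"
    and nonneg: "\<And>\<epsilon> \<delta>. \<epsilon> \<in> hypercube n \<Longrightarrow> \<delta> \<in> hypercube n \<Longrightarrow> 0 \<le> L \<epsilon> \<delta>"
    and row: "\<And>\<epsilon>. \<epsilon> \<in> hypercube n \<Longrightarrow> (\<Sum>\<delta>\<in>hypercube n. L \<epsilon> \<delta>) = 1"
    and column: "\<And>\<delta>. \<delta> \<in> hypercube n \<Longrightarrow> (\<Sum>\<epsilon>\<in>hypercube n. L \<epsilon> \<delta>) = 1"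
    and bound: "\<And>\<epsilon>. \<epsilon> \<in> hypercube n \<Longrightarrow>
        norm (g \<epsilon>) \<le> C * (\<Sum>\<delta>\<in>hypercube n. L \<epsilon> \<delta> * norm (f \<delta>))"
  shows "cube_Lp_norm n p g \<le> C * cube_Lp_norm n p f"
proof (cases "p = \<infinity>")
  case True
  define M where "M = Max ((\<lambda>\<epsilon>. norm (f \<epsilon>)) ` hypercube n)"
  have "norm (g \<epsilon>) \<le> C * M" if \<epsilon>: "\<epsilon> \<in> hypercube n" for \<epsilon>
  proof -
    have "(\<Sum>\<delta>\<in>hypercube n. L \<epsilon> \<delta> * norm (f \<delta>)) \<le> (\<Sum>\<delta>\<in>hypercube n. L \<epsilon> \<delta> * M)"
      using nonneg \<epsilon> by (intro sum_mono mult_left_mono) (auto simp: M_def finite_hypercube)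
    also have "\<dots> = M" using row[OF \<epsilon>] by (simp flip: sum_distrib_right)
    finally show ?thesis using bound[OF \<epsilon>] C mult_left_mono order_trans by blast
  qed
  then show ?thesis
    using True by (simp add: cube_Lp_norm_def M_def finite_hypercube hypercube_nonempty)
next
  case False
  define q where "q = real_of_ereal p"
  have q: "1 \<le> q"
    using p False by (cases p) (auto simp: q_def)
  have conv: "norm (g \<epsilon>) powr q \<le> C powr q * (\<Sum>\<delta>\<in>hypercube n. L \<epsilon> \<delta> * norm (f \<delta>) powr q)"
    if \<epsilon>: "\<epsilon> \<in> hypercube n" for \<epsilon>
  proof -
    let ?a = "\<Sum>\<delta>\<in>hypercube n. L \<epsilon> \<delta> * norm (f \<delta>)"
    have "norm (g \<epsilon>) powr q \<le> (C * ?a) powr q"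
      using bound[OF \<epsilon>] q by (intro powr_mono2) auto
    also have "\<dots> = C powr q * ?a powr q"
      using C nonneg[OF \<epsilon>] by (intro powr_mult)
    also have "?a powr q \<le> (\<Sum>\<delta>\<in>hypercube n. L \<epsilon> \<delta> * norm (f \<delta>) powr q)"
      using convex_on_sum[OF finite_hypercube hypercube_nonempty convex_on_powr_nonneg[OF q]
          row[OF \<epsilon>] nonneg[OF \<epsilon>], of "\<lambda>\<delta>. norm (f \<delta>)"] by simp
    finally show ?thesis by (simp add: mult_left_mono)
  qed
  have "(\<Sum>\<epsilon>\<in>hypercube n. norm (g \<epsilon>) powr q)
      \<le> (\<Sum>\<epsilon>\<in>hypercube n. C powr q * (\<Sum>\<delta>\<in>hypercube n. L \<epsilon> \<delta> * norm (f \<delta>) powr q))"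
    by (intro sum_mono conv)
  also have "\<dots> = C powr q * (\<Sum>\<delta>\<in>hypercube n. (\<Sum>\<epsilon>\<in>hypercube n. L \<epsilon> \<delta>) * norm (f \<delta>) powr q)"
    unfolding sum_distrib_right sum_distrib_left by (rule sum.swap)
  also have "\<dots> = C powr q * (\<Sum>\<delta>\<in>hypercube n. norm (f \<delta>) powr q)"
    using column by simp
  finally have "(1 / 2 ^ n) * (\<Sum>\<epsilon>\<in>hypercube n. norm (g \<epsilon>) powr q)
      \<le> C powr q * ((1 / 2 ^ n) * (\<Sum>\<delta>\<in>hypercube n. norm (f \<delta>) powr q))"
    by (simp add: divide_right_mono)
  then have "((1 / 2 ^ n) * (\<Sum>\<epsilon>\<in>hypercube n. norm (g \<epsilon>) powr q)) powr (1 / q)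
      \<le> (C powr q * ((1 / 2 ^ n) * (\<Sum>\<delta>\<in>hypercube n. norm (f \<delta>) powr q))) powr (1 / q)"
    using q by (intro powr_mono2) (simp_all add: sum_nonneg)
  also have "\<dots> = C * ((1 / 2 ^ n) * (\<Sum>\<delta>\<in>hypercube n. norm (f \<delta>) powr q)) powr (1 / q)"
    using q C by (subst powr_mult) (auto simp: powr_powr sum_nonneg)
  finally show ?thesis
    using False by (simp add: cube_Lp_norm_def q_def)
qed

section \<open>The Bernstein--Markov inequality on the cube\<close>

theorem theorem4:
  fixes n d :: nat
    and p :: ereal
    and f :: "(nat \<Rightarrow> real) \<Rightarrow> 'a::complex_banach"
  assumes "n \<ge> 1" and "d \<in> {1..n}"
    and "1 \<le> p"
    and "degree_at_most n d f"
  shows "cube_Lp_norm n p (laplacian n f) \<le> (real d)\<^sup>2 * cube_Lp_norm n p f"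
proof -
  have d: "d > 0" using assms(2) by simp
  \<comment> \<open>A convex combination of noise kernels, the absolute weights being normalised by their sum \<open>d\<^sup>2\<close>.\<close>
  define L where "L \<epsilon> \<delta> = (\<Sum>j<2*d. \<bar>node_weight d j\<bar> * noise_kernel n (cos (node d j)) \<epsilon> \<delta>)
      / (real d)\<^sup>2" for \<epsilon> \<delta>
  have L_commute: "L \<epsilon> \<delta> = L \<delta> \<epsilon>" for \<epsilon> \<delta>
    by (simp add: L_def noise_kernel_commute[of n _ \<epsilon>])
  have row: "(\<Sum>\<delta>\<in>hypercube n. L \<epsilon> \<delta>) = 1" for \<epsilon>
  proof -
    have "(\<Sum>\<delta>\<in>hypercube n. L \<epsilon> \<delta>)
        = (\<Sum>j<2*d. \<bar>node_weight d j\<bar> * (\<Sum>\<delta>\<in>hypercube n. noise_kernel n (cos (node d j)) \<epsilon> \<delta>))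
          / (real d)\<^sup>2"
      unfolding L_def sum_divide_distrib[symmetric] sum_distrib_left by (subst sum.swap) simp
    also have "\<dots> = 1"
      using d by (simp add: noise_kernel_sum sum_abs_node_weight)
    finally show ?thesis .
  qed
  show ?thesis
  proof (rule cube_Lp_norm_stochastic_kernel[where L = L])
    fix \<epsilon> \<delta> assume "\<epsilon> \<in> hypercube n" "\<delta> \<in> hypercube n"
    then show "0 \<le> L \<epsilon> \<delta>"
      unfolding L_def
      by (intro divide_nonneg_nonneg sum_nonneg mult_nonneg_nonneg noise_kernel_nonneg) auto
  next
    fix \<epsilon> assume \<epsilon>: "\<epsilon> \<in> hypercube n"
    have "norm (laplacian n f \<epsilon>)
        \<le> (\<Sum>j<2*d. \<Sum>\<delta>\<in>hypercube n.
             \<bar>node_weight d j\<bar> * (noise_kernel n (cos (node d j)) \<epsilon> \<delta> * norm (f \<delta>)))"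
      unfolding laplacian_eq_noise_combination[OF d assms(4)] scaleR_sum_right
      by (intro order_trans[OF norm_sum] sum_mono)
        (simp add: \<epsilon> noise_kernel_nonneg abs_mult mult.assoc)
    also have "\<dots> = (real d)\<^sup>2 * (\<Sum>\<delta>\<in>hypercube n. L \<epsilon> \<delta> * norm (f \<delta>))"
      using d by (subst sum.swap)
        (simp add: L_def sum_distrib_left sum_distrib_right sum_divide_distrib mult.assoc)
    finally show "norm (laplacian n f \<epsilon>)
        \<le> (real d)\<^sup>2 * (\<Sum>\<delta>\<in>hypercube n. L \<epsilon> \<delta> * norm (f \<delta>))" .
  next
    fix \<delta>
    show "(\<Sum>\<epsilon>\<in>hypercube n. L \<epsilon> \<delta>) = 1"
      using row[of \<delta>] by (simp only: L_commute[of _ \<delta>])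
  qed (use assms(3) row in simp_all)
qed

end
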